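(* Let $(L,[-,-]_1,[-,-]_2)$ be a compatible Leibniz algebra over a field $\mathbb{K}$ such that the associated ternary Leibniz algebras $(L,\{-,-,-\}_1)$ and $(L,\{-,-,-\}_2)$, where $\{x,y,z\}_i=[x,[y,z]_i]_i$, are compatible. Let $D:L\to L$ be a generalized derivation on the compatible Leibniz algebra $(L,[-,-]_1,[-,-]_2)$ such that, for linear maps $D',D'',D''':L\to L$, \begin{align*} D''([x,y]_i)&=[D(x),y]_i+[x,D'(y)]_i,\\ D'''([x,y]_i)&=[D(x),y]_i+[x,D''(y)]_i, \end{align*} for all $x,y\in L$ and $i=1,2$. Then $D$ is a generalized derivation of the compatible ternary Leibniz algebra $(L,\{-,-,-\}_1,\{-,-,-\}_2)$.
   Context: A Leibniz algebra is a vector space $L$ with a bilinear bracket satisfying $[[x,y],z]=[x,[y,z]]+[[x,z],y]$. A compatible Leibniz algebra is a triple $(L,[-,-]_1,[-,-]_2)$ with both brackets Leibniz and $\lambda_1[-,-]_1+\lambda_2[-,-]_2$ a Leibniz bracket for all $\lambda_1,\lambda_2\in\mathbb{K}$. A generalized derivation of a Leibniz algebra is a linear map $D$ for which there exist linear maps $D',D''$ with $D''([x,y])=[D(x),y]+[x,D'(y)]$ for all $x,y$; on a compatible Leibniz algebra it is one that is a generalized derivation for both brackets. A ternary Leibniz algebra is a vector space with a trilinear bracket satisfying $\{\{x,y,z\},t,u\}=\{x,y,\{z,t,u\}\}+\{x,\{y,t,u\},z\}+\{\{x,t,u\},y,z\}$. For any Leibniz algebra $(L,[-,-])$, $(L,\{x,y,z\}:=[x,[y,z]])$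 is a ternary Leibniz algebra, called the associated one. Two ternary Leibniz brackets on $L$ are compatible if \begin{align*} \{\{x,y,z\}_1,t,u\}_2+\{\{x,y,z\}_2,t,u\}_1&=\{x,y,\{z,t,u\}_1\}_2+\{x,y,\{z,t,u\}_2\}_1+\{x,\{y,t,u\}_1,z\}_2\\ &\quad+\{x,\{y,t,u\}_2,z\}_1+\{\{x,t,u\}_1,y,z\}_2+\{\{x,t,u\}_2,y,z\}_1 \end{align*} for all $x,y,z,t,u$; then $(L,\{\cdot\}_1,\{\cdot\}_2)$ is a compatible ternary Leibniz algebra. A generalized derivation of a ternary Leibniz algebra is a linear map $D$ for which there exist linear maps $E',E'',E'''$ with $E'''(\{x,y,z\})=\{D(x),y,z\}+\{x,E'(y),z\}+\{x,y,E''(z)\}$ for all $x,y,z$; a generalized derivation of a compatible ternary Leibniz algebra is a linear map that is a generalized derivation for both brackets. *)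

theory Defs
  imports Complex_Main
begin

text \<open>
  All algebras live on a whole type carrying a vector space structure over an arbitrary field,
  in the sense of the locale \<open>vector_space\<close>; no restriction on dimension or characteristic.
\<close>

locale leibniz_algebra = vector_space scale
  for scale :: "'k::field \<Rightarrow> 'v::ab_group_add \<Rightarrow> 'v" +
  fixes br :: "'v \<Rightarrow> 'v \<Rightarrow> 'v"
  assumes linear_left: "Vector_Spaces.linear scale scale (\<lambda>x. br x y)"
    and linear_right: "Vector_Spaces.linear scale scale (\<lambda>y. br x y)"
    and leibniz: "br (br x y) z = br x (br y z) + br (br x z) y"

locale compatible_leibniz_algebra =
  L1: leibniz_algebra scale br1 + L2: leibniz_algebra scale br2
  for scale :: "'k::field \<Rightarrow> 'v::ab_group_add \<Rightarrow> 'v"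
    and br1 br2 :: "'v \<Rightarrow> 'v \<Rightarrow> 'v" +
  assumes pencil: "leibniz_algebra scale (\<lambda>x y. scale a (br1 x y) + scale b (br2 x y))"

definition generalized_derivation ::
  "('k::field \<Rightarrow> 'v::ab_group_add \<Rightarrow> 'v) \<Rightarrow> ('v \<Rightarrow> 'v \<Rightarrow> 'v) \<Rightarrow> ('v \<Rightarrow> 'v) \<Rightarrow> bool"
  where "generalized_derivation scale br D \<longleftrightarrow>
    Vector_Spaces.linear scale scale D \<and>
    (\<exists>D' D''. Vector_Spaces.linear scale scale D' \<and> Vector_Spaces.linear scale scale D'' \<and>
      (\<forall>x y. D'' (br x y) = br (D x) y + br x (D' y)))"

text \<open>The auxiliary linear maps are allowed to depend on the bracket.\<close>

definition compatible_generalized_derivation ::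
  "('k::field \<Rightarrow> 'v::ab_group_add \<Rightarrow> 'v) \<Rightarrow> ('v \<Rightarrow> 'v \<Rightarrow> 'v) \<Rightarrow> ('v \<Rightarrow> 'v \<Rightarrow> 'v) \<Rightarrow>
    ('v \<Rightarrow> 'v) \<Rightarrow> bool"
  where "compatible_generalized_derivation scale br1 br2 D \<longleftrightarrow>
    generalized_derivation scale br1 D \<and> generalized_derivation scale br2 D"

locale ternary_leibniz_algebra = vector_space scale
  for scale :: "'k::field \<Rightarrow> 'v::ab_group_add \<Rightarrow> 'v" +
  fixes tr :: "'v \<Rightarrow> 'v \<Rightarrow> 'v \<Rightarrow> 'v"
  assumes linear_1: "Vector_Spaces.linear scale scale (\<lambda>x. tr x y z)"
    and linear_2: "Vector_Spaces.linear scale scale (\<lambda>y. tr x y z)"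
    and linear_3: "Vector_Spaces.linear scale scale (\<lambda>z. tr x y z)"
    and ternary_leibniz:
      "tr (tr x y z) t u = tr x y (tr z t u) + tr x (tr y t u) z + tr (tr x t u) y z"

definition compatible_ternary_brackets ::
  "('v::ab_group_add \<Rightarrow> 'v \<Rightarrow> 'v \<Rightarrow> 'v) \<Rightarrow> ('v \<Rightarrow> 'v \<Rightarrow> 'v \<Rightarrow> 'v) \<Rightarrow> bool"
  where "compatible_ternary_brackets tr1 tr2 \<longleftrightarrow>
    (\<forall>x y z t u.
      tr2 (tr1 x y z) t u + tr1 (tr2 x y z) t u =
        tr2 x y (tr1 z t u) + tr1 x y (tr2 z t u) + tr2 x (tr1 y t u) z
        + tr1 x (tr2 y t u) z + tr2 (tr1 x t u) y z + tr1 (tr2 x t u) y z)"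

locale compatible_ternary_leibniz_algebra =
  T1: ternary_leibniz_algebra scale tr1 + T2: ternary_leibniz_algebra scale tr2
  for scale :: "'k::field \<Rightarrow> 'v::ab_group_add \<Rightarrow> 'v"
    and tr1 tr2 :: "'v \<Rightarrow> 'v \<Rightarrow> 'v \<Rightarrow> 'v" +
  assumes compatible: "compatible_ternary_brackets tr1 tr2"

definition ternary_generalized_derivation ::
  "('k::field \<Rightarrow> 'v::ab_group_add \<Rightarrow> 'v) \<Rightarrow> ('v \<Rightarrow> 'v \<Rightarrow> 'v \<Rightarrow> 'v) \<Rightarrow> ('v \<Rightarrow> 'v) \<Rightarrow> bool"
  where "ternary_generalized_derivation scale tr D \<longleftrightarrow>
    Vector_Spaces.linear scale scale D \<and>
    (\<exists>E' E'' E'''. Vector_Spaces.linear scale scale E' \<and> Vector_Spaces.linear scale scale E'' \<and>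
      Vector_Spaces.linear scale scale E''' \<and>
      (\<forall>x y z. E''' (tr x y z) = tr (D x) y z + tr x (E' y) z + tr x y (E'' z)))"

definition compatible_ternary_generalized_derivation ::
  "('k::field \<Rightarrow> 'v::ab_group_add \<Rightarrow> 'v) \<Rightarrow> ('v \<Rightarrow> 'v \<Rightarrow> 'v \<Rightarrow> 'v) \<Rightarrow>
    ('v \<Rightarrow> 'v \<Rightarrow> 'v \<Rightarrow> 'v) \<Rightarrow> ('v \<Rightarrow> 'v) \<Rightarrow> bool"
  where "compatible_ternary_generalized_derivation scale tr1 tr2 D \<longleftrightarrow>
    ternary_generalized_derivation scale tr1 D \<and> ternary_generalized_derivation scale tr2 D"

definition associated_ternary :: "('v \<Rightarrow> 'v \<Rightarrow> 'v) \<Rightarrow> 'v \<Rightarrow> 'v \<Rightarrow> 'v \<Rightarrow> 'v"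
  where "associated_ternary br x y z = br x (br y z)"

lemma (in leibniz_algebra) ternary_leibniz_algebra_associated:
  "ternary_leibniz_algebra scale (associated_ternary br)"
proof (intro ternary_leibniz_algebra.intro ternary_leibniz_algebra_axioms.intro)
  show "vector_space scale" by (rule vector_space_axioms)
  have comp: "Vector_Spaces.linear scale scale (\<lambda>x. f (g x))"
    if "Vector_Spaces.linear scale scale f" "Vector_Spaces.linear scale scale g" for f g
    using Vector_Spaces.linear_compose[OF that(2) that(1)] by (simp add: o_def)
  fix x y z t u :: "'v"
  show "Vector_Spaces.linear scale scale (\<lambda>x. associated_ternary br x y z)"
    unfolding associated_ternary_def by (rule linear_left)
  show "Vector_Spaces.linear scale scale (\<lambda>y. associated_ternary br x y z)"
    unfolding associated_ternary_def by (rule comp[OF linear_right linear_left])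
  show "Vector_Spaces.linear scale scale (\<lambda>z. associated_ternary br x y z)"
    unfolding associated_ternary_def by (rule comp[OF linear_right linear_right])
  have add: "br a (b + c) = br a b + br a c" for a b c
    using linear_right[of a] by (simp add: Vector_Spaces.linear_iff)
  define w where "w = br t u"
  have "br (br x (br y z)) w = br x (br (br y z) w) + br (br x w) (br y z)"
    by (rule leibniz)
  also have "br (br y z) w = br y (br z w) + br (br y w) z"
    by (rule leibniz)
  finally show "associated_ternary br (associated_ternary br x y z) t u =
      associated_ternary br x y (associated_ternary br z t u)
      + associated_ternary br x (associated_ternary br y t u) z
      + associated_ternary br (associated_ternary br x t u) y z"
    by (simp add: associated_ternary_def w_def add)
qed

text \<open>
  Hence, over a compatible Leibniz algebra, compatibility of the two associated brackets is all
  that is needed for them to form a compatible ternary Leibniz algebra.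
\<close>

lemma (in compatible_leibniz_algebra) compatible_ternary_leibniz_algebra_associated:
  assumes "compatible_ternary_brackets (associated_ternary br1) (associated_ternary br2)"
  shows "compatible_ternary_leibniz_algebra scale (associated_ternary br1) (associated_ternary br2)"
  using assms L1.ternary_leibniz_algebra_associated L2.ternary_leibniz_algebra_associated
  by (simp add: compatible_ternary_leibniz_algebra_def compatible_ternary_leibniz_algebra_axioms_def)

end

theory Submission
  imports Defs
begin

text \<open>
  The two hypotheses on \<open>D\<close> apply in succession to the nested bracket \<open>[x, [y, z]]\<close>:
  \<open>D'''\<close> crosses the outer bracket and leaves \<open>D''\<close> acting on \<open>[y, z]\<close>, which the
  relation between \<open>D''\<close>, \<open>D\<close> and \<open>D'\<close> expands. Hence
  \<open>D''' [x, [y, z]] = [D x, [y, z]] + [x, [D y, z]] + [x, [y, D' z]]\<close>,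
  and \<open>D\<close>, \<open>D'\<close>, \<open>D'''\<close> serve as the linear maps that accompany \<open>D\<close> on the ternary
  algebra. The argument concerns one bracket at a time
  (\<open>ternary_generalized_derivation_associated\<close>).
\<close>

text \<open>
  The map for the second argument is \<open>D\<close> itself, because crossing the inner bracket with
  \<open>D''\<close> puts \<open>D\<close> on its first entry. Additivity of the outer bracket in its second
  argument then separates the two inner terms.
\<close>

lemma (in leibniz_algebra) ternary_generalized_derivation_associated:
  assumes lin: "Vector_Spaces.linear scale scale D" "Vector_Spaces.linear scale scale D'"
      "Vector_Spaces.linear scale scale D'''"
    and inner: "\<And>x y. D'' (br x y) = br (D x) y + br x (D' y)"
    and outer: "\<And>x y. D''' (br x y) = br (D x) y + br x (D'' y)"
  shows "ternary_generalized_derivation scale (associated_ternary br) D"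
proof -
  have add: "br a (b + c) = br a b + br a c" for a b c
    using linear_right[of a] by (simp add: Vector_Spaces.linear_iff)
  have "D''' (associated_ternary br x y z) = associated_ternary br (D x) y z
      + associated_ternary br x (D y) z + associated_ternary br x y (D' z)" for x y z
    by (simp add: associated_ternary_def outer inner add add.assoc)
  with lin show ?thesis
    unfolding ternary_generalized_derivation_def by blast
qed

theorem proposition2p4:
  fixes scale :: "'k::field \<Rightarrow> 'v::ab_group_add \<Rightarrow> 'v"
    and br1 br2 :: "'v \<Rightarrow> 'v \<Rightarrow> 'v"
    and D D' D'' D''' :: "'v \<Rightarrow> 'v"
  assumes "compatible_leibniz_algebra scale br1 br2"
    and "compatible_ternary_brackets (associated_ternary br1) (associated_ternary br2)"
    and "compatible_generalized_derivation scale br1 br2 D"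
    and "Vector_Spaces.linear scale scale D'"
    and "Vector_Spaces.linear scale scale D''"
    and "Vector_Spaces.linear scale scale D'''"
    and "\<And>x y. D'' (br1 x y) = br1 (D x) y + br1 x (D' y)"
    and "\<And>x y. D'' (br2 x y) = br2 (D x) y + br2 x (D' y)"
    and "\<And>x y. D''' (br1 x y) = br1 (D x) y + br1 x (D'' y)"
    and "\<And>x y. D''' (br2 x y) = br2 (D x) y + br2 x (D'' y)"
  shows "compatible_ternary_generalized_derivation scale
    (associated_ternary br1) (associated_ternary br2) D"
proof -
  interpret compatible_leibniz_algebra scale br1 br2 by fact
  have D: "Vector_Spaces.linear scale scale D"
    using assms(3)
    by (simp add: compatible_generalized_derivation_def generalized_derivation_def)
  show ?thesis
    unfolding compatible_ternary_generalized_derivation_def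
    using L1.ternary_generalized_derivation_associated[OF D assms(4,6,7,9)]
      L2.ternary_generalized_derivation_associated[OF D assms(4,6,8,10)]
    by simp
qed

end
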